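(* Let $G$ be a finite simple graph that does not contain a 4-vertex cycle $C_4$ as an induced subgraph. Then $G$ is strongly reconstructible from its digital convexity $\mathscr{D}(G)$; that is, for every graph $H$ on the same vertex set as $G$, $\mathscr{D}(G) = \mathscr{D}(H)$ implies $G = H$.
   Context: All graphs are simple and finite. For a vertex $v$ of a graph $G$, the closed neighborhood is $N_G[v] = \{v\} \cup N_G(v)$, where $N_G(v)$ is the set of vertices adjacent to $v$; for $S \subseteq V(G)$, $N_G[S] = \bigcup_{v \in S} N_G[v]$. A set $S \subseteq V(G)$ is digitally convex if for each vertex $v \notin S$ there is a vertex $x \in N_G[v] \setminus N_G[S]$. The digital convexity $\mathscr{D}(G)$ is the collection of all digitally convex sets of $G$. A (labeled) graph $G$ is strongly reconstructible from a parameter $p(G)$ if, for every (labeled) graph $H$ on the same vertex set as $G$, $p(G) = p(H)$ implies $G = H$ (equality of labeled graphs, i.e. the same edge set). *)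

theory Defs
  imports "Graph_Theory.Graph_Theory"
begin

text \<open>
  A finite simple graph is a \<^locale>\<open>pair_graph\<close>: a vertex set together with a symmetric irreflexive
  arc relation on it, both finite; an undirected edge is the pair of its two arcs. Hence equality
  of two such records is equality of labeled graphs.
\<close>

definition nbhd :: "'a pair_pre_digraph \<Rightarrow> 'a \<Rightarrow> 'a set" where
  "nbhd G v = {u. (v, u) \<in> parcs G}"

definition closed_nbhd :: "'a pair_pre_digraph \<Rightarrow> 'a \<Rightarrow> 'a set" where
  "closed_nbhd G v = {v} \<union> nbhd G v"

definition closed_nbhd_set :: "'a pair_pre_digraph \<Rightarrow> 'a set \<Rightarrow> 'a set" where
  "closed_nbhd_set G S = (\<Union>v\<in>S. closed_nbhd G v)"

definition digitally_convex :: "'a pair_pre_digraph \<Rightarrow> 'a set \<Rightarrow> bool" where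
  "digitally_convex G S \<longleftrightarrow> S \<subseteq> pverts G \<and>
     (\<forall>v \<in> pverts G - S. \<exists>x. x \<in> closed_nbhd G v - closed_nbhd_set G S)"

definition digital_convexity :: "'a pair_pre_digraph \<Rightarrow> 'a set set" where
  "digital_convexity G = {S. digitally_convex G S}"

definition strongly_reconstructible ::
    "('a pair_pre_digraph \<Rightarrow> 'b) \<Rightarrow> 'a pair_pre_digraph \<Rightarrow> bool" where
  "strongly_reconstructible p G \<longleftrightarrow>
     (\<forall>H. pair_graph H \<and> pverts H = pverts G \<longrightarrow> p G = p H \<longrightarrow> G = H)"

text \<open>The cycle on the vertices \<open>0, \<dots>, n - 1\<close>; meaningful for \<open>n \<ge> 3\<close>.\<close>

definition cycle_graph :: "nat \<Rightarrow> nat pair_pre_digraph" where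
  "cycle_graph n = \<lparr> pverts = {..<n},
     parcs = {(i, j). i < n \<and> j < n \<and> (j = Suc i mod n \<or> i = Suc j mod n)} \<rparr>"

definition contains_induced :: "'a pair_pre_digraph \<Rightarrow> 'b pair_pre_digraph \<Rightarrow> bool" where
  "contains_induced G K \<longleftrightarrow>
     (\<exists>F. induced_subgraph F (with_proj G) \<and> digraph_iso F (with_proj K))"

end

theory Submission
  imports Defs
begin

text \<open>
  Write \<open>N[v]\<close> for closed neighbourhoods. The complements of the digitally convex sets of \<open>G\<close> are
  exactly the unions of closed neighbourhoods of \<open>G\<close>, so the digital convexity amounts to a
  union-closed family of vertex sets, generated by the \<open>N[v]\<close> but with the labels \<open>v\<close> forgotten.
  Suppose \<open>G\<close> and \<open>H\<close>, with closed neighbourhoods \<open>N\<close> and \<open>N'\<close>, generate the same family.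

  Some information survives the loss of labels. Since \<open>N[a]\<close> is also the set of labels \<open>v\<close> with
  \<open>a \<in> N[v]\<close>, the inclusion \<open>N[a] \<subseteq> N[b]\<close> says that every member of the family containing \<open>a\<close>
  contains \<open>b\<close>; hence \<open>N\<close> and \<open>N'\<close> induce the same preorder on the vertices, in particular the same
  twins (\<open>nbhd_subset_iff\<close>). In the same way, whether \<open>N[a]\<close> is irreducible, that is, not the union
  of strictly smaller closed neighbourhoods, can be read off the family (\<open>irreducibles_eq\<close>). As any
  \<open>N[v]\<close> is a union of irreducible ones, adjacency is determined by the preorder and by adjacency
  between irreducible vertices (\<open>nbhd_eqI\<close>), and it remains to compare \<open>G\<close> and \<open>H\<close> there.

  An irreducible \<open>N[a]\<close> must equal some irreducible \<open>N'[b]\<close>; put \<open>\<pi> a = b\<close>. Symmetry of both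
  adjacencies gives the shift rule \<open>a \<sim> \<pi> b \<longleftrightarrow> \<pi> a \<sim> b\<close> in \<open>G\<close> (with \<open>\<sim>\<close> reflexive), and
  \<open>a \<sim> \<pi> a\<close>. So each \<open>\<pi>\<close>-orbit is a clique, and whether \<open>\<pi>\<^sup>i u \<sim> \<pi>\<^sup>j v\<close> depends only on \<open>i + j\<close>;
  call this truth value \<open>g (i + j)\<close>. Modulo twins \<open>\<pi>\<close> is a permutation, so \<open>g\<close> is periodic.
  Adjacency of \<open>u\<close> and \<open>v\<close> is \<open>g 0\<close> in \<open>G\<close> and \<open>g (-1)\<close> in \<open>H\<close>. If these differ, the periodic \<open>g\<close>
  must both drop, from \<open>j\<close> to \<open>j + 1\<close>, and rise, from \<open>l\<close> to \<open>l + 1\<close>. Then \<open>u\<close>, \<open>\<pi>\<^sup>j v\<close>, \<open>\<pi>\<^sup>l v\<close>,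
  \<open>\<pi> u\<close> is an induced 4-cycle of \<open>G\<close>: two of its sides lie in cliques, the other two are given by
  \<open>g j\<close> and \<open>g (l + 1)\<close>, and the diagonals are missing by \<open>g l\<close> and \<open>g (j + 1)\<close>.
\<close>

section \<open>Families of closed neighbourhoods\<close>

locale nbhds =
  fixes V :: "'a set" and N :: "'a \<Rightarrow> 'a set"
  assumes finite_V: "finite V"
    and nbhd_subset: "v \<in> V \<Longrightarrow> N v \<subseteq> V"
    and nbhd_refl: "v \<in> V \<Longrightarrow> v \<in> N v"
    and nbhd_sym: "v \<in> V \<Longrightarrow> u \<in> N v \<Longrightarrow> v \<in> N u"
begin

lemma nbhd_sym_iff: "u \<in> V \<Longrightarrow> v \<in> V \<Longrightarrow> u \<in> N v \<longleftrightarrow> v \<in> N u"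
  using nbhd_sym by blast

definition irreducibles :: "'a set" where
  "irreducibles = {a \<in> V. \<exists>x \<in> N a. \<forall>b \<in> V. N b \<subset> N a \<longrightarrow> x \<notin> N b}"

lemma irreducibles_subset: "irreducibles \<subseteq> V"
  by (auto simp: irreducibles_def)

text \<open>
  A reducible neighbourhood is covered by strictly smaller ones, so by finiteness the descent ends
  in irreducible ones.
\<close>

lemma irreducible_cover:
  assumes "v \<in> V" "x \<in> N v"
  shows "\<exists>b \<in> irreducibles. x \<in> N b \<and> N b \<subseteq> N v"
  using assms
proof (induction "card (N v)" arbitrary: v rule: less_induct)
  case less
  show ?case
  proof (cases "v \<in> irreducibles")
    case False
    then obtain b where b: "b \<in> V" "N b \<subset> N v" "x \<in> N b"
      using less.prems unfolding irreducibles_def mem_Collect_eq by meson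
    have "finite (N v)"
      using nbhd_subset[OF less.prems(1)] finite_V by (rule finite_subset)
    with b have "card (N b) < card (N v)"
      by (intro psubset_card_mono)
    then obtain c where "c \<in> irreducibles" "x \<in> N c" "N c \<subseteq> N b"
      using less.hyps[of b] b by auto
    with b show ?thesis
      by (intro bexI[of _ c]) auto
  qed (use less.prems in blast)
qed

end

section \<open>Two families generating the same unions\<close>

locale same_unions = G: nbhds V N + H: nbhds V N' for V :: "'a set" and N N' +
  assumes cover: "\<And>v x. v \<in> V \<Longrightarrow> x \<in> N v \<Longrightarrow> \<exists>y \<in> V. x \<in> N' y \<and> N' y \<subseteq> N v"
    and cover': "\<And>v x. v \<in> V \<Longrightarrow> x \<in> N' v \<Longrightarrow> \<exists>y \<in> V. x \<in> N y \<and> N y \<subseteq> N' v"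
begin

lemma swap: "same_unions V N' N"
  using cover cover' by unfold_locales

text \<open>
  \<open>N a \<subseteq> N b\<close> holds iff every union of neighbourhoods containing \<open>a\<close> contains \<open>b\<close>; apply this to
  the unions \<open>N' y\<close>.
\<close>

lemma nbhd_subsetD:
  assumes "a \<in> V" "b \<in> V" "N a \<subseteq> N b"
  shows "N' a \<subseteq> N' b"
proof
  fix y assume "y \<in> N' a"
  then have y: "y \<in> V" "a \<in> N' y"
    using assms(1) H.nbhd_subset H.nbhd_sym by blast+
  then obtain z where z: "z \<in> V" "a \<in> N z" "N z \<subseteq> N' y"
    using cover' by blast
  then have "b \<in> N z"
    using assms G.nbhd_sym by blast
  then show "y \<in> N' b"
    using y z H.nbhd_sym by blast
qed

lemma nbhd_subset_iff: "a \<in> V \<Longrightarrow> b \<in> V \<Longrightarrow> N a \<subseteq> N b \<longleftrightarrow> N' a \<subseteq> N' b"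
  using nbhd_subsetD same_unions.nbhd_subsetD[OF swap] by metis

lemma twins_iff: "a \<in> V \<Longrightarrow> b \<in> V \<Longrightarrow> N a = N b \<longleftrightarrow> N' a = N' b"
  by (simp add: set_eq_subset nbhd_subset_iff)

text \<open>
  By symmetry of adjacency, irreducibility of \<open>a\<close> can be witnessed by a neighbourhood that contains
  \<open>a\<close> but no vertex strictly below \<open>a\<close> in the common preorder. If \<open>N x\<close> is such a witness, then so
  is any \<open>N' y \<subseteq> N x\<close> containing \<open>a\<close>.
\<close>

lemma irreducibles_subset_irreducibles: "G.irreducibles \<subseteq> H.irreducibles"
proof
  fix a assume "a \<in> G.irreducibles"
  then obtain x where a: "a \<in> V" and x: "x \<in> N a" "\<And>b. b \<in> V \<Longrightarrow> N b \<subset> N a \<Longrightarrow> x \<notin> N b"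
    by (auto simp: G.irreducibles_def)
  have xV: "x \<in> V" and ax: "a \<in> N x"
    using a x(1) G.nbhd_subset G.nbhd_sym by blast+
  then obtain y where y: "y \<in> V" "a \<in> N' y" "N' y \<subseteq> N x"
    using cover by blast
  have "y \<notin> N' b" if b: "b \<in> V" "N' b \<subset> N' a" for b
  proof
    assume "y \<in> N' b"
    then have "b \<in> N x"
      using b y H.nbhd_sym by blast
    then have "x \<in> N b"
      using xV G.nbhd_sym by blast
    moreover have "N b \<subset> N a"
      using b a nbhd_subset_iff by (simp add: less_le_not_le)
    ultimately show False
      using x(2) b by blast
  qed
  moreover have "y \<in> N' a"
    using y H.nbhd_sym by blast
  ultimately show "a \<in> H.irreducibles"
    using a by (auto simp: H.irreducibles_def)
qed

text \<open>
  Let \<open>x \<in> N a\<close> lie in no strictly smaller \<open>N b\<close>. Covering \<open>N a\<close> around \<open>x\<close> by some \<open>N' y\<close>, and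
  that again by some \<open>N b\<close>, yields \<open>N b \<subseteq> N' y \<subseteq> N a\<close> with \<open>x \<in> N b\<close>, so all three are equal.
\<close>

lemma irreducible_transfer:
  assumes "a \<in> G.irreducibles"
  shows "\<exists>y \<in> H.irreducibles. N' y = N a"
proof -
  obtain x where a: "a \<in> V" and x: "x \<in> N a" "\<And>b. b \<in> V \<Longrightarrow> N b \<subset> N a \<Longrightarrow> x \<notin> N b"
    using assms by (auto simp: G.irreducibles_def)
  obtain y where y: "y \<in> H.irreducibles" "x \<in> N' y" "N' y \<subseteq> N a"
    using cover[OF a x(1)] H.irreducible_cover by (meson subset_trans)
  then obtain b where "b \<in> V" "x \<in> N b" "N b \<subseteq> N' y"
    using cover' H.irreducibles_subset by blast
  with x(2) y have "N' y = N a"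
    by blast
  with y show ?thesis
    by blast
qed

lemma irreducibles_eq: "H.irreducibles = G.irreducibles"
  using irreducibles_subset_irreducibles
    same_unions.irreducibles_subset_irreducibles[OF swap] by blast

text \<open>
  If \<open>u\<close> and \<open>v\<close> are adjacent, there are adjacent irreducible vertices \<open>b\<close> below \<open>u\<close> and \<open>c\<close> below
  \<open>v\<close>, and conversely adjacency moves upwards in the preorder.
\<close>

lemma nbhd_subset_nbhd:
  assumes agree: "\<And>a b. a \<in> G.irreducibles \<Longrightarrow> b \<in> G.irreducibles \<Longrightarrow> a \<in> N b \<Longrightarrow> a \<in> N' b"
    and v: "v \<in> V"
  shows "N v \<subseteq> N' v"
proof
  fix u assume u: "u \<in> N v"
  then have uV: "u \<in> V" and "v \<in> N u"
    using v G.nbhd_subset G.nbhd_sym by blast+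
  then obtain b where b: "b \<in> G.irreducibles" "v \<in> N b" "N b \<subseteq> N u"
    using G.irreducible_cover by blast
  then have bV: "b \<in> V" and "b \<in> N v"
    using G.irreducibles_subset G.nbhd_sym by blast+
  then obtain c where c: "c \<in> G.irreducibles" "b \<in> N c" "N c \<subseteq> N v"
    using G.irreducible_cover v by blast
  then have cV: "c \<in> V" and "b \<in> N' c"
    using G.irreducibles_subset agree b by blast+
  moreover have "N' c \<subseteq> N' v" "N' b \<subseteq> N' u"
    using nbhd_subset_iff b(3) c(3) bV cV uV v by blast+
  ultimately have "v \<in> N' u"
    using bV v H.nbhd_sym by blast
  then show "u \<in> N' v"
    using uV H.nbhd_sym by blast
qed

lemma nbhd_eqI:
  assumes "\<And>a b. a \<in> G.irreducibles \<Longrightarrow> b \<in> G.irreducibles \<Longrightarrow> a \<in> N b \<longleftrightarrow> a \<in> N' b"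
    and "v \<in> V"
  shows "N v = N' v"
proof
  show "N v \<subseteq> N' v"
    using assms by (intro nbhd_subset_nbhd) auto
  show "N' v \<subseteq> N v"
    using assms by (intro same_unions.nbhd_subset_nbhd[OF swap]) (auto simp: irreducibles_eq)
qed

end

section \<open>Relabelled neighbourhoods and induced 4-cycles\<close>

lemma boolean_drop:
  fixes g :: "nat \<Rightarrow> bool"
  assumes "g 0" "\<not> g n"
  shows "\<exists>i. g i \<and> \<not> g (Suc i)"
  using assms by (induction n) auto

text \<open>
  This is what \<open>same_unions\<close> provides on the irreducible vertices \<open>M\<close>. The map \<open>p\<close> plays the role
  of \<open>\<pi>\<close>; it involves a choice among twins.
\<close>

locale relabelling = G: nbhds V N + H: nbhds V N' for V :: "'a set" and N N' +
  fixes M :: "'a set" and p :: "'a \<Rightarrow> 'a"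
  assumes M_subset: "M \<subseteq> V"
    and p_in: "a \<in> M \<Longrightarrow> p a \<in> M"
    and nbhd_p: "a \<in> M \<Longrightarrow> N' (p a) = N a"
    and twins: "a \<in> M \<Longrightarrow> b \<in> M \<Longrightarrow> N a = N b \<longleftrightarrow> N' a = N' b"
begin

lemma M_in_V: "a \<in> M \<Longrightarrow> a \<in> V"
  using M_subset by blast

lemma funpow_p_in: "a \<in> M \<Longrightarrow> (p ^^ i) a \<in> M"
  by (induction i) (auto simp: p_in)

lemma shift: "a \<in> M \<Longrightarrow> b \<in> M \<Longrightarrow> a \<in> N (p b) \<longleftrightarrow> p a \<in> N b"
  using nbhd_p G.nbhd_sym_iff H.nbhd_sym_iff M_in_V p_in by metis

lemma p_adjacent: "a \<in> M \<Longrightarrow> p a \<in> N a"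
  using nbhd_p H.nbhd_refl M_in_V p_in by metis

text \<open>
  Shifting moves both endpoints of the orbit segment from \<open>a\<close> to \<open>p\<^sup>d a\<close> inwards, which reduces \<open>d\<close>
  by two.
\<close>

lemma orbit_adjacent: "a \<in> M \<Longrightarrow> a \<in> N ((p ^^ d) a)"
proof (induction d arbitrary: a rule: induct_nat_012)
  case 0
  then show ?case
    by (simp add: G.nbhd_refl M_in_V)
next
  case 1
  then show ?case
    using p_adjacent G.nbhd_sym M_in_V by auto
next
  case (ge2 d)
  have "p a \<in> N ((p ^^ d) (p a))"
    using ge2 p_in by blast
  then show ?case
    using shift[of a "p ((p ^^ d) a)"] ge2.prems p_in funpow_p_in by (simp add: funpow_swap1)
qed

lemma orbit_clique:
  assumes "a \<in> M"
  shows "(p ^^ i) a \<in> N ((p ^^ j) a)"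
proof (induction i j rule: linorder_wlog)
  case (le i j)
  have "(p ^^ j) a = (p ^^ (j - i)) ((p ^^ i) a)"
    using le by (metis comp_apply funpow_add le_add_diff_inverse2)
  then show ?case
    using orbit_adjacent funpow_p_in assms by metis
next
  case (sym i j)
  then show ?case
    using G.nbhd_sym M_in_V funpow_p_in assms by blast
qed

text \<open>
  \<open>p\<close> need not be injective, but it is injective up to twins, so a coincidence in the orbit can be
  traced back to its beginning.
\<close>

lemma orbit_periodic:
  assumes "v \<in> M"
  shows "\<exists>q. N ((p ^^ Suc q) v) = N v"
proof -
  have cancel: "N ((p ^^ d) v) = N v" if "N ((p ^^ (i + d)) v) = N ((p ^^ i) v)" for i d
    using that
  proof (induction i)
    case (Suc i)
    then have "N' (p ((p ^^ (i + d)) v)) = N' (p ((p ^^ i) v))"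
      using twins assms p_in funpow_p_in by simp
    then show ?case
      using Suc.IH nbhd_p assms funpow_p_in by simp
  qed simp
  have "range (\<lambda>i. (p ^^ i) v) \<subseteq> V"
    using assms funpow_p_in M_in_V by blast
  then have "\<not> inj (\<lambda>i. (p ^^ i) v)"
    using G.finite_V finite_subset range_inj_infinite by blast
  then obtain i j where "(p ^^ i) v = (p ^^ j) v" "i < j"
    by (auto simp: inj_def) (metis linorder_neqE_nat)
  with cancel[of i "Suc (j - Suc i)"] show ?thesis
    by auto
qed

lemma induced_four_cycle:
  assumes u: "u \<in> M" and v: "v \<in> M" and diff: "u \<in> N v \<longleftrightarrow> u \<notin> N' v"
  shows "\<exists>a \<in> V. \<exists>b \<in> V. \<exists>c \<in> V. \<exists>d \<in> V.
    b \<in> N a \<and> c \<in> N b \<and> d \<in> N c \<and> a \<in> N d \<and> c \<notin> N a \<and> d \<notin> N b"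
proof -
  define g where "g i \<longleftrightarrow> u \<in> N ((p ^^ i) v)" for i
  have g_Suc: "g (Suc i) \<longleftrightarrow> p u \<in> N ((p ^^ i) v)" for i
    using shift[OF u funpow_p_in[OF v]] by (simp add: g_def)
  obtain q where q: "N ((p ^^ Suc q) v) = N v"
    using orbit_periodic[OF v] by blast
  \<comment> \<open>Up to twins, \<open>p\<^sup>q\<close> inverts \<open>p\<close> at \<open>v\<close>, so \<open>g q\<close> is adjacency for \<open>N'\<close>.\<close>
  have "N' ((p ^^ Suc q) v) = N' v"
    using q twins[OF funpow_p_in[OF v] v] by (rule iffD1[rotated])
  then have "g q \<longleftrightarrow> u \<in> N' v"
    using nbhd_p[OF funpow_p_in[OF v]] by (simp add: g_def)
  moreover have "g (Suc q) \<longleftrightarrow> u \<in> N v" and "g 0 \<longleftrightarrow> u \<in> N v"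
    using q by (simp_all add: g_def)
  ultimately have change: "g q \<longleftrightarrow> \<not> g 0" "g (Suc q) \<longleftrightarrow> g 0"
    using diff by simp_all
  obtain j where j: "g j" "\<not> g (Suc j)"
    using boolean_drop[of g q] change by (cases "g 0") auto
  obtain l where l: "\<not> g l" "g (Suc l)"
    using boolean_drop[of "\<lambda>i. \<not> g i" q] change by (cases "g 0") auto
  let ?b = "(p ^^ j) v" and ?c = "(p ^^ l) v" and ?d = "p u"
  have in_V: "u \<in> V" "?b \<in> V" "?c \<in> V" "?d \<in> V"
    by (rule M_in_V; simp add: u v funpow_p_in p_in)+
  have "u \<in> N ?b" "u \<notin> N ?c" and b: "?d \<in> N ?c" "?d \<notin> N ?b"
    using j l unfolding g_Suc by (simp_all add: g_def)
  then have "?b \<in> N u" "?c \<notin> N u"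
    using in_V G.nbhd_sym_iff by blast+
  moreover have "?c \<in> N ?b"
    using v by (rule orbit_clique)
  moreover have "u \<in> N ?d"
    using p_adjacent[OF u] in_V G.nbhd_sym by blast
  ultimately show ?thesis
    using b in_V by (intro bexI[of _ u] bexI[of _ ?b] bexI[of _ ?c] bexI[of _ ?d] conjI)
qed

end

text \<open>
  Adjacency that differs at all differs between irreducible vertices, where a choice function for
  \<open>irreducible_transfer\<close> relabels the neighbourhoods.
\<close>

lemma (in same_unions) nbhd_eq_or_four_cycle:
  assumes "v \<in> V" "N v \<noteq> N' v"
  shows "\<exists>a \<in> V. \<exists>b \<in> V. \<exists>c \<in> V. \<exists>d \<in> V.
    b \<in> N a \<and> c \<in> N b \<and> d \<in> N c \<and> a \<in> N d \<and> c \<notin> N a \<and> d \<notin> N b"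
proof -
  have "\<forall>a \<in> G.irreducibles. \<exists>y. y \<in> G.irreducibles \<and> N' y = N a"
    using irreducible_transfer irreducibles_eq by blast
  then obtain p where p: "\<forall>a \<in> G.irreducibles. p a \<in> G.irreducibles \<and> N' (p a) = N a"
    by metis
  interpret relabelling V N N' G.irreducibles p
    using p twins_iff G.irreducibles_subset by unfold_locales blast+
  have "\<not> (\<forall>a \<in> G.irreducibles. \<forall>b \<in> G.irreducibles. a \<in> N b \<longleftrightarrow> a \<in> N' b)"
    using nbhd_eqI[of v] assms by auto
  then obtain a b where "a \<in> G.irreducibles" "b \<in> G.irreducibles" "a \<in> N b \<longleftrightarrow> a \<notin> N' b"
    by blast
  then show ?thesis
    by (rule induced_four_cycle)
qed

section \<open>From digital convexities to unions of neighbourhoods\<close>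

lemma adjacent_sym: "pair_graph G \<Longrightarrow> (u, v) \<in> parcs G \<Longrightarrow> (v, u) \<in> parcs G"
  using pair_sym_digraph.pair_sym_arcs[of G]
  by (auto simp: pair_graph_def pair_pseudo_graph_def symmetric_def sym_def)

lemma nbhds_closed_nbhd:
  assumes "pair_graph G"
  shows "nbhds (pverts G) (closed_nbhd G)"
proof -
  interpret pair_graph G
    by fact
  show ?thesis
    using adjacent_sym[OF assms] pair_finite_verts in_arcsD2
    by unfold_locales (auto simp: closed_nbhd_def nbhd_def)
qed

text \<open>
  The complement of \<open>N[v]\<close> is convex in \<open>G\<close>, because \<open>v\<close> itself is a private neighbour of every
  vertex of \<open>N[v]\<close>. Convexity of the same set in \<open>H\<close> says that each \<open>x \<in> N[v]\<close> lies in some closed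
  neighbourhood of \<open>H\<close> that avoids the complement, that is, is contained in \<open>N[v]\<close>.
\<close>

lemma convexity_cover:
  assumes G: "pair_graph G" and H: "pair_graph H" and verts: "pverts H = pverts G"
    and conv: "digital_convexity G = digital_convexity H"
    and v: "v \<in> pverts G" and x: "x \<in> closed_nbhd G v"
  shows "\<exists>y \<in> pverts G. x \<in> closed_nbhd H y \<and> closed_nbhd H y \<subseteq> closed_nbhd G v"
proof -
  interpret G: nbhds "pverts G" "closed_nbhd G"
    using G by (rule nbhds_closed_nbhd)
  interpret H: nbhds "pverts G" "closed_nbhd H"
    using nbhds_closed_nbhd[OF H] verts by simp
  let ?S = "pverts G - closed_nbhd G v"
  have "v \<in> closed_nbhd G w - closed_nbhd_set G ?S" if "w \<in> pverts G - ?S" for w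
    using that v G.nbhd_sym by (auto simp: closed_nbhd_set_def)
  then have "digitally_convex G ?S"
    unfolding digitally_convex_def by blast
  then have "digitally_convex H ?S"
    using conv by (auto simp: digital_convexity_def)
  moreover have "x \<in> pverts G - ?S"
    using v x G.nbhd_subset by blast
  ultimately obtain y where y: "y \<in> closed_nbhd H x" "y \<notin> closed_nbhd_set H ?S"
    using verts unfolding digitally_convex_def by blast
  have yV: "y \<in> pverts G" and "x \<in> closed_nbhd H y"
    using y(1) v x G.nbhd_subset H.nbhd_subset H.nbhd_sym by blast+
  moreover have "closed_nbhd H y \<subseteq> closed_nbhd G v"
    using y(2) yV H.nbhd_subset H.nbhd_sym unfolding closed_nbhd_set_def by blast
  ultimately show ?thesis
    by blast
qed

lemma pverts_cycle_graph_4: "pverts (cycle_graph 4) = {0, 1, 2, 3}"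
  by (auto simp: cycle_graph_def)

lemma parcs_cycle_graph_4:
  "parcs (cycle_graph 4) = {(0, 1), (1, 2), (2, 3), (3, 0), (1, 0), (2, 1), (3, 2), (0, 3)}"
    (is "_ = ?C")
proof
  show "?C \<subseteq> parcs (cycle_graph 4)"
    by (simp add: cycle_graph_def)
  show "parcs (cycle_graph 4) \<subseteq> ?C"
  proof (rule subrelI)
    fix i j assume "(i, j) \<in> parcs (cycle_graph 4)"
    then have "i \<in> pverts (cycle_graph 4)" "j \<in> pverts (cycle_graph 4)"
      and "j = Suc i mod 4 \<or> i = Suc j mod 4"
      by (simp_all add: cycle_graph_def)
    then show "(i, j) \<in> ?C"
      unfolding pverts_cycle_graph_4 by (elim insertE emptyE) simp_all
  qed
qed

text \<open>
  The four vertices are distinct, since consecutive ones have different neighbours among the four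
  and opposite ones are non-adjacent; they are mapped to \<open>0, 1, 2, 3\<close> in this order.
\<close>

lemma contains_induced_four_cycle:
  assumes G: "pair_graph G"
    and V: "a \<in> pverts G" "b \<in> pverts G" "c \<in> pverts G" "d \<in> pverts G"
    and sides: "b \<in> closed_nbhd G a" "c \<in> closed_nbhd G b" "d \<in> closed_nbhd G c"
      "a \<in> closed_nbhd G d"
    and diagonals: "c \<notin> closed_nbhd G a" "d \<notin> closed_nbhd G b"
  shows "contains_induced G (cycle_graph 4)"
proof -
  interpret pair_graph G
    by fact
  interpret C: nbhds "pverts G" "closed_nbhd G"
    using G by (rule nbhds_closed_nbhd)
  have distinct: "a \<noteq> b" "a \<noteq> c" "a \<noteq> d" "b \<noteq> c" "b \<noteq> d" "c \<noteq> d"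
    using sides diagonals V C.nbhd_sym C.nbhd_refl by metis+
  have edges: "(a, b) \<in> parcs G" "(b, c) \<in> parcs G" "(c, d) \<in> parcs G" "(d, a) \<in> parcs G"
    using sides distinct by (auto simp: closed_nbhd_def nbhd_def)
  then have edges': "(b, a) \<in> parcs G" "(c, b) \<in> parcs G" "(d, c) \<in> parcs G" "(a, d) \<in> parcs G"
    using adjacent_sym[OF G] by auto
  have nonedges: "(a, c) \<notin> parcs G" "(b, d) \<notin> parcs G"
    using diagonals by (auto simp: closed_nbhd_def nbhd_def)
  then have nonedges': "(c, a) \<notin> parcs G" "(d, b) \<notin> parcs G"
    using adjacent_sym[OF G] by auto
  have loops: "(x, x) \<notin> parcs G" for x
    using no_loops' by blast
  define f :: "'a \<Rightarrow> nat" where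
    "f x = (if x = a then 0 else if x = b then 1 else if x = c then 2 else 3)" for x
  have f: "f a = 0" "f b = 1" "f c = 2" "f d = 3"
    using distinct by (auto simp: f_def)
  let ?S = "{a, b, c, d}"
  let ?F = "with_proj G \<restriction> ?S"
  let ?h = "\<lparr>iso_verts = f, iso_arcs = map_prod f f, iso_head = snd, iso_tail = fst\<rparr>"
  have inj: "inj_on f ?S"
    by (simp add: inj_on_def f)
  let ?C = "{(a, b), (b, c), (c, d), (d, a), (b, a), (c, b), (d, c), (a, d)}"
  have arc_iff: "(x, y) \<in> arcs ?F \<longleftrightarrow> (x, y) \<in> parcs G \<and> x \<in> ?S \<and> y \<in> ?S" for x y
    unfolding induce_subgraph_arcs with_proj_simps mem_Collect_eq fst_conv snd_conv by (rule refl)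
  have arcs: "arcs ?F = ?C"
  proof
    show "?C \<subseteq> arcs ?F"
      unfolding insert_subset arc_iff using edges edges' by blast
    show "arcs ?F \<subseteq> ?C"
    proof (rule subrelI)
      fix x y assume "(x, y) \<in> arcs ?F"
      then have "(x, y) \<in> parcs G" "x \<in> ?S" "y \<in> ?S"
        unfolding arc_iff by blast+
      then show "(x, y) \<in> ?C"
        by (elim insertE emptyE) (simp_all add: loops nonedges nonedges')
    qed
  qed
  have "arcs ?F \<subseteq> ?S \<times> ?S"
    unfolding arcs by simp
  with map_prod_inj_on[OF inj inj] have inj_arcs: "inj_on (map_prod f f) (arcs ?F)"
    by (rule inj_on_subset)
  have iso: "pre_digraph.digraph_isomorphism ?F ?h"
    unfolding pre_digraph.digraph_isomorphism_def
  proof (intro conjI ballI)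
    show "wf_digraph ?F"
      by (rule wellformed_induce_subgraph)
    show "inj_on (iso_verts ?h) (verts ?F)"
      unfolding induce_subgraph_verts digraph_isomorphism.simps by (rule inj)
    show "inj_on (iso_arcs ?h) (arcs ?F)"
      unfolding digraph_isomorphism.simps by (rule inj_arcs)
  qed simp_all
  have "with_proj (cycle_graph 4) = app_iso ?h ?F"
    unfolding app_iso_def arcs by (simp add: with_proj_def parcs_cycle_graph_4 pverts_cycle_graph_4 f)
  with iso have "digraph_iso ?F (with_proj (cycle_graph 4))"
    unfolding digraph_iso_def by blast
  moreover have "induced_subgraph ?F (with_proj G)"
    using V by (intro induced_induce) auto
  ultimately show ?thesis
    unfolding contains_induced_def by blast
qed

lemma parcs_conv_closed_nbhd:
  assumes "pair_graph G"
  shows "parcs G = {(v, u). v \<in> pverts G \<and> u \<in> closed_nbhd G v \<and> u \<noteq> v}"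
proof -
  interpret pair_graph G
    by fact
  show ?thesis
    using in_arcsD1 no_loops' by (auto simp: closed_nbhd_def nbhd_def)
qed

theorem theorem1p6:
  fixes G :: "'a pair_pre_digraph"
  assumes "pair_graph G"
    and "\<not> contains_induced G (cycle_graph 4)"
  shows "strongly_reconstructible digital_convexity G"
  unfolding strongly_reconstructible_def
proof (intro allI impI)
  fix H :: "'a pair_pre_digraph"
  assume "pair_graph H \<and> pverts H = pverts G" and conv: "digital_convexity G = digital_convexity H"
  then have H: "pair_graph H" and verts: "pverts H = pverts G"
    by auto
  interpret G: nbhds "pverts G" "closed_nbhd G"
    using assms(1) by (rule nbhds_closed_nbhd)
  interpret H: nbhds "pverts G" "closed_nbhd H"
    using nbhds_closed_nbhd[OF H] verts by simp
  interpret same_unions "pverts G" "closed_nbhd G" "closed_nbhd H"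
    using convexity_cover[OF assms(1) H verts conv]
      convexity_cover[OF H assms(1) verts[symmetric] conv[symmetric]] verts
    by unfold_locales auto
  have "closed_nbhd G v = closed_nbhd H v" if "v \<in> pverts G" for v
    using nbhd_eq_or_four_cycle[OF that] contains_induced_four_cycle[OF assms(1)] assms(2) by blast
  then have "parcs G = parcs H"
    unfolding parcs_conv_closed_nbhd[OF assms(1)] parcs_conv_closed_nbhd[OF H] verts by auto
  then show "G = H"
    using verts by simp
qed

end
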